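(* Let $\mathcal{C}_1=(\mathcal{A}_1,\mathcal{G}_1)$ and $\mathcal{C}_2=(\mathcal{A}_2,\mathcal{G}_2)$ be contracts with $\mathcal{A}_j: A_j(\tfrac{d}{dt})u=0$ and $\mathcal{G}_j: G_j(\tfrac{d}{dt})y=0$. Then the conjunction of $\mathcal{C}_1$ and $\mathcal{C}_2$ is $(\mathcal{A}_1\vee\mathcal{A}_2,\ \mathcal{G}_1\wedge\mathcal{G}_2)$; that is, the contract $(\mathcal{A}_1\vee\mathcal{A}_2,\mathcal{G}_1\wedge\mathcal{G}_2)$ refines both $\mathcal{C}_1$ and $\mathcal{C}_2$, and every contract that refines both $\mathcal{C}_1$ and $\mathcal{C}_2$ refines $(\mathcal{A}_1\vee\mathcal{A}_2,\mathcal{G}_1\wedge\mathcal{G}_2)$.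
   Context: $C^\infty(\mathbb{R},\mathbb{R}^n)$ is the space of smooth functions $\mathbb{R}\to\mathbb{R}^n$; for a real polynomial matrix $R(s)=\sum_i R_is^i$, $R(\tfrac{d}{dt})w=\sum_i R_i w^{(i)}$. A system $\Sigma: P(\tfrac{d}{dt})y=Q(\tfrac{d}{dt})u$ (real polynomial matrices $P,Q$, $u\in C^\infty(\mathbb{R},\mathbb{R}^m)$, $y\in C^\infty(\mathbb{R},\mathbb{R}^p)$) is in input-output form if $P(s)$ is square and invertible and $P(s)^{-1}Q(s)$ is a proper rational matrix; its external behaviour is $\mathfrak{B}(\Sigma)=\{(u,y): P(\tfrac{d}{dt})y=Q(\tfrac{d}{dt})u\}$. An environment is $\mathcal{E}: 0=E(\tfrac{d}{dt})u$ with input behaviour $\mathfrak{B}_i(\mathcal{E})=\{u: E(\tfrac{d}{dt})u=0\}$. Assumptions $\mathcal{A}: 0=A(\tfrac{d}{dt})u$ have input behaviour $\mathfrak{B}_i(\mathcal{A})=\{u:A(\tfrac{d}{dt})u=0\}$; guarantees $\mathcal{G}: G(\tfrac{d}{dt})y=0$ have output behaviour $\mathfrak{B}_o(\mathcal{G})=\{y:G(\tfrac{d}{dt})y=0\}$ (all $A,E,G$ real polynomial matrices; assumptions may also be given via latent variables, in which case $\mathfrak{B}_i$ is the set of $u$ for which latent variables exist satisfying the equations). The interconnection of an environment $\mathcal{E}$ with $\Sigma$ has output behaviour $\mathfrak{B}_o(\mathcal{E}\wedge\Sigma)=\{y:\exists u\in\mathfrak{B}_i(\mathcal{E}),\ (u,y)\in\mathfrak{B}(\Sigma)\}$.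 A contract is a pair $\mathcal{C}=(\mathcal{A},\mathcal{G})$. An environment $\mathcal{E}$ is compatible with $\mathcal{C}$ if $\mathfrak{B}_i(\mathcal{E})\subset\mathfrak{B}_i(\mathcal{A})$; a system $\Sigma$ in input-output form implements $\mathcal{C}$ if $\mathfrak{B}_o(\mathcal{E}\wedge\Sigma)\subset\mathfrak{B}_o(\mathcal{G})$ for every environment $\mathcal{E}$ compatible with $\mathcal{C}$. Contract $\mathcal{C}_1$ refines $\mathcal{C}_2$ if every environment compatible with $\mathcal{C}_2$ is compatible with $\mathcal{C}_1$ and every implementation of $\mathcal{C}_1$ is an implementation of $\mathcal{C}_2$. The conjunction $\mathcal{C}_1\wedge\mathcal{C}_2$ is the largest (with respect to refinement) contract that refines both $\mathcal{C}_1$ and $\mathcal{C}_2$. The join $\mathcal{A}_1\vee\mathcal{A}_2$ is the assumptions with latent variables $l_1,l_2\in C^\infty(\mathbb{R},\mathbb{R}^m)$ given by $l_1+l_2=u$, $A_1(\tfrac{d}{dt})l_1=0$, $A_2(\tfrac{d}{dt})l_2=0$, i.e. $\mathfrak{B}_i(\mathcal{A}_1\vee\mathcal{A}_2)=\{u:\exists l_1,l_2 \text{ smooth with } l_1+l_2=u,\ A_1(\tfrac{d}{dt})l_1=0,\ A_2(\tfrac{d}{dt})l_2=0\}$. The meet $\mathcal{G}_1\wedge\mathcal{G}_2$ is the guarantees $\begin{bmatrix}G_1(\tfrac{d}{dt})\\ G_2(\tfrac{d}{dt})\end{bmatrix}y=0$. *)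

theory Defs
  imports "HOL-Analysis.Analysis" "HOL-Computational_Algebra.Polynomial"
begin

type_synonym 'n signal = "real \<Rightarrow> real ^ 'n"

definition smooth_sig :: "'n::finite signal \<Rightarrow> bool" where
  "smooth_sig w \<longleftrightarrow> (\<forall>i k t. ((deriv ^^ k) (\<lambda>s. w s $ i)) differentiable (at t))"

definition pdiff :: "real poly ^ 'n \<Rightarrow> 'n::finite signal \<Rightarrow> real \<Rightarrow> real" where
  "pdiff r w t = (\<Sum>i\<in>UNIV. \<Sum>k\<le>degree (r $ i). coeff (r $ i) k * (deriv ^^ k) (\<lambda>s. w s $ i) t)"

definition ker_list :: "(real poly ^ 'n) list \<Rightarrow> 'n::finite signal set" where
  "ker_list R = {w. smooth_sig w \<and> (\<forall>r\<in>set R. \<forall>t. pdiff r w t = 0)}"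

definition ker_mat :: "real poly ^ 'n ^ 'r \<Rightarrow> 'n::finite signal set" where
  "ker_mat R = {w. smooth_sig w \<and> (\<forall>j t. pdiff (R $ j) w t = 0)}"

definition latent_beh :: "real poly ^ 'm ^ 'r \<Rightarrow> real poly ^ 'l ^ 'r \<Rightarrow> 'm::finite signal set" where
  "latent_beh R M = {u. smooth_sig u \<and> (\<exists>l :: 'l::finite signal. smooth_sig l \<and>
      (\<forall>j t. pdiff (R $ j) u t = pdiff (M $ j) l t))}"

definition join_beh :: "real poly ^ 'm ^ 'a1 \<Rightarrow> real poly ^ 'm ^ 'a2 \<Rightarrow> 'm::finite signal set" where
  "join_beh A1 A2 = {u. \<exists>l1 l2. smooth_sig l1 \<and> smooth_sig l2 \<and> (\<forall>t. l1 t + l2 t = u t) \<and>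
      l1 \<in> ker_mat A1 \<and> l2 \<in> ker_mat A2}"

definition meet_mat :: "real poly ^ 'p ^ 'g1 \<Rightarrow> real poly ^ 'p ^ 'g2 \<Rightarrow> real poly ^ 'p ^ ('g1 + 'g2)" where
  "meet_mat G1 G2 = (\<chi> r. case r of Inl i \<Rightarrow> G1 $ i | Inr i \<Rightarrow> G2 $ i)"

text \<open>Adjugate: adj(P)_ij = cofactor C_ji = det of P with row j replaced by e_i.\<close>
definition adjugate_mat :: "'a::comm_ring_1 ^ 'n ^ 'n \<Rightarrow> 'a ^ 'n ^ 'n" where
  "adjugate_mat P = (\<chi> i j. det (\<chi> k. if k = j then axis i 1 else P $ k))"

text \<open>Input-output form: P square and invertible (det P \<noteq> 0), and
  P^{-1} Q = adj(P) Q / det P is proper (entrywise numerator degree \<le> denominator degree).\<close>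
definition io_form :: "real poly ^ 'p ^ 'p \<Rightarrow> real poly ^ 'm ^ 'p \<Rightarrow> bool" where
  "io_form P Q \<longleftrightarrow> det P \<noteq> 0 \<and>
     (\<forall>i j. degree ((adjugate_mat P ** Q) $ i $ j) \<le> degree (det P))"

definition sys_beh :: "real poly ^ 'p ^ 'p \<Rightarrow> real poly ^ 'm ^ 'p \<Rightarrow> ('m::finite signal \<times> 'p::finite signal) set" where
  "sys_beh P Q = {(u, y). smooth_sig u \<and> smooth_sig y \<and> (\<forall>i t. pdiff (P $ i) y t = pdiff (Q $ i) u t)}"

definition out_beh :: "(real poly ^ 'm) list \<Rightarrow> real poly ^ 'p ^ 'p \<Rightarrow> real poly ^ 'm ^ 'p \<Rightarrow> 'p::finite signal set" where
  "out_beh E P Q = {y. \<exists>u \<in> ker_list E. (u, y) \<in> sys_beh P Q}"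

text \<open>A contract is represented by its pair (B_i(A), B_o(G)); all notions below only depend on these.\<close>
type_synonym ('m, 'p) contract = "'m signal set \<times> 'p signal set"

definition compatible :: "(real poly ^ 'm) list \<Rightarrow> ('m::finite, 'p) contract \<Rightarrow> bool" where
  "compatible E C \<longleftrightarrow> ker_list E \<subseteq> fst C"

definition implements :: "real poly ^ 'p ^ 'p \<Rightarrow> real poly ^ 'm ^ 'p \<Rightarrow> ('m::finite, 'p::finite) contract \<Rightarrow> bool" where
  "implements P Q C \<longleftrightarrow> io_form P Q \<and> (\<forall>E. compatible E C \<longrightarrow> out_beh E P Q \<subseteq> snd C)"

definition refines :: "('m::finite, 'p::finite) contract \<Rightarrow> ('m, 'p) contract \<Rightarrow> bool" where
  "refines C1 C2 \<longleftrightarrow> (\<forall>E. compatible E C2 \<longrightarrow> compatible E C1) \<and>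
     (\<forall>P Q. implements P Q C1 \<longrightarrow> implements P Q C2)"

end

theory Submission
  imports Defs
begin

text \<open>
  Only one point needs work: a contract refines \<open>(ker A, ker H)\<close> with guarantees \<open>ker G\<close> only if
  \<open>ker G \<subseteq> ker H\<close>. The systems \<open>P y = 0\<close> with \<open>ker P \<subseteq> ker G\<close> implement the contract and have output
  behaviour \<open>ker P\<close>, whatever the environment, so \<open>ker P \<subseteq> ker H\<close> for all such nonsingular \<open>P\<close>.
  Suppose that a row \<open>h\<close> of \<open>H\<close> is not in the row module of \<open>G\<close>. A submodule of \<open>\<real>[s]\<^sup>p\<close> maximal among
  those that contain the rows of \<open>G\<close> but not \<open>h\<close> has a torsion quotient, hence is the row module of a
  nonsingular \<open>P\<close>. Then \<open>ker P \<subseteq> ker G\<close>, so \<open>ker P \<subseteq> ker h\<close>, which forces \<open>h\<close> into the row module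
  of \<open>P\<close>, a contradiction.
\<close>

subsection \<open>Row modules of polynomial matrices\<close>

text \<open>Here \<open>rowmod.subspace\<close> means submodule: the scalars will be polynomials,
  which form only a ring.\<close>

interpretation rowmod: module "(*s) :: 'a::comm_ring_1 \<Rightarrow> 'a ^ 'n \<Rightarrow> 'a ^ 'n"
  by unfold_locales (vector algebra_simps)+

section \<open>Adjugates and divisibility by the determinant\<close>

text \<open>Cramer's rule: the determinant is linear in row \<open>j\<close>, so expanding
  \<open>r\<close> there in unit vectors produces column \<open>j\<close> of the adjugate.\<close>

lemma vector_matrix_mult_adjugate_nth:
  fixes P :: "'a::comm_ring_1 ^ 'n ^ 'n"
  shows "(r v* adjugate_mat P) $ j = det (\<chi> k. if k = j then r else P $ k)"
proof -
  have "det (\<chi> k. if k = j then r else P $ k)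
      = det (\<chi> k. if k = j then (\<Sum>i\<in>UNIV. r $ i *s axis i 1) else P $ k)"
    by (simp only: basis_expansion)
  also have "\<dots> = (\<Sum>i\<in>UNIV. det (\<chi> k. if k = j then r $ i *s axis i 1 else P $ k))"
    by (rule det_linear_row_sum[OF finite])
  also have "\<dots> = (\<Sum>i\<in>UNIV. r $ i * det (\<chi> k. if k = j then axis i 1 else P $ k))"
    by (subst det_row_mul) simp
  finally show ?thesis
    by (simp add: vector_matrix_mult_def adjugate_mat_def)
qed

text \<open>By Cramer's rule, entry \<open>j\<close> is the determinant of \<open>P\<close> with row
  \<open>j\<close> replaced by row \<open>i\<close>: either \<open>P\<close> is unchanged, or two
  rows coincide.\<close>

lemma row_mult_adjugate:
  fixes P :: "'a::comm_ring_1 ^ 'n ^ 'n"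
  shows "(P $ i) v* adjugate_mat P = det P *s axis i 1"
proof -
  have "((P $ i) v* adjugate_mat P) $ j = (det P *s axis i 1) $ j" for j
  proof (cases "i = j")
    case True
    have "(\<chi> k. if k = j then P $ j else P $ k) = P"
      by (simp add: vec_eq_iff)
    then show ?thesis
      unfolding True by (simp add: vector_matrix_mult_adjugate_nth axis_def)
  next
    case False
    then have "det (\<chi> k. if k = j then P $ i else P $ k) = 0"
      by (rule det_identical_rows) (simp add: row_def vec_eq_iff)
    then show ?thesis
      using False by (simp add: vector_matrix_mult_adjugate_nth axis_def)
  qed
  then show ?thesis
    by (subst vec_eq_iff) blast
qed

lemma matrix_mult_adjugate:
  fixes P :: "'a::comm_ring_1 ^ 'n ^ 'n"
  shows "x v* (P ** adjugate_mat P) = det P *s x"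
proof -
  have "(P ** adjugate_mat P) $ i = (P $ i) v* adjugate_mat P" for i
    by (simp add: matrix_matrix_mult_def vector_matrix_mult_def vec_eq_iff)
  then have *: "(P ** adjugate_mat P) $ i $ j = (if i = j then det P else 0)" for i j
    by (simp add: row_mult_adjugate axis_def)
  show ?thesis
    by (simp add: vec_eq_iff vector_matrix_mult_def * if_distrib mult.commute cong: if_cong)
qed

lemma vector_matrix_mult_adjugate_cancel:
  fixes P :: "'a::idom ^ 'n ^ 'n"
  assumes "det P \<noteq> 0" and "x v* adjugate_mat P = y v* adjugate_mat P"
  shows "x = y"
proof -
  let ?A = "adjugate_mat P"
  have "P ** ?A = (\<chi> i j. if i = j then det P else 0)"
    by (simp add: vec_eq_iff matrix_matrix_mult_def row_mult_adjugate[unfolded vector_matrix_mult_def vec_eq_iff, simplified] axis_def)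
  then have "det (P ** ?A) = (\<Prod>i::'n\<in>UNIV. det P)"
    by (simp add: det_diagonal)
  then have "det ?A \<noteq> 0"
    using assms(1) by (auto simp: det_mul)
  \<comment> \<open>The adjugate of \<open>?A\<close> inverts \<open>?A\<close> up to the nonzero
    factor \<open>det ?A\<close>.\<close>
  have "x v* ?A v* adjugate_mat ?A = y v* ?A v* adjugate_mat ?A"
    using assms(2) by simp
  then have "det ?A *s x = det ?A *s y"
    by (simp only: vector_matrix_mul_assoc matrix_mult_adjugate)
  with \<open>det ?A \<noteq> 0\<close> show ?thesis
    by (simp add: vec_eq_iff)
qed

text \<open>If \<open>q\<close> denotes the vector of quotients,
  \<open>r adj P = det P q = q P adj P\<close>, and \<open>adj P\<close> cancels.\<close>

lemma mem_rowspace_if_det_dvd: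
  fixes P :: "'a::idom ^ 'n ^ 'n"
  assumes "det P \<noteq> 0" and "\<And>j. det P dvd (r v* adjugate_mat P) $ j"
  shows "r \<in> range (\<lambda>x. x v* P)"
proof -
  obtain q where q: "\<And>j. (r v* adjugate_mat P) $ j = det P * q j"
    using assms(2) unfolding dvd_def by metis
  have "r v* adjugate_mat P = det P *s vec_lambda q"
    by (simp add: vec_eq_iff q)
  also have "\<dots> = vec_lambda q v* P v* adjugate_mat P"
    by (simp only: vector_matrix_mul_assoc matrix_mult_adjugate)
  finally have "r = vec_lambda q v* P"
    using vector_matrix_mult_adjugate_cancel[OF assms(1)] by blast
  then show ?thesis by blast
qed

section \<open>Submodules of polynomial row vectors\<close>

lemma subspace_rowspace: "rowmod.subspace (range (\<lambda>x. x v* (G :: 'a::comm_ring_1 ^ 'n ^ 'r)))"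
proof (rule rowmod.subspaceI)
  show "0 \<in> range (\<lambda>x. x v* G)"
    using rangeI[of "\<lambda>x. x v* G" 0] by simp
next
  fix x y assume "x \<in> range (\<lambda>x. x v* G)" "y \<in> range (\<lambda>x. x v* G)"
  then obtain a b where "x = a v* G" "y = b v* G" by blast
  then show "x + y \<in> range (\<lambda>x. x v* G)"
    by (simp flip: vector_matrix_left_distrib)
next
  fix c x assume "x \<in> range (\<lambda>x. x v* G)"
  then obtain a where "x = a v* G" by blast
  then have "c *s x = (c *s a) v* G"
    by (simp add: vec_eq_iff vector_matrix_mult_def sum_distrib_left mult.assoc)
  then show "c *s x \<in> range (\<lambda>x. x v* G)"
    by blast
qed

lemma vector_matrix_mult_in_subspace:
  assumes "rowmod.subspace N" "\<And>i. P $ i \<in> N"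
  shows "x v* P \<in> N"
proof -
  have "x v* P = (\<Sum>i\<in>UNIV. x $ i *s P $ i)"
    by (simp add: vec_eq_iff vector_matrix_mult_def)
  then show ?thesis
    using assms by (simp add: rowmod.subspace_sum rowmod.subspace_scale)
qed

lemma row_in_rowspace: "P $ i \<in> range (\<lambda>x. x v* (P :: 'a::comm_ring_1 ^ 'n ^ 'r))"
proof
  show "P $ i = axis i 1 v* P"
    by (simp add: vec_eq_iff vector_matrix_mult_def axis_def if_distrib[where f = "\<lambda>x. x * _"] cong: if_cong)
qed simp

text \<open>In the quotient by a submodule maximal among those avoiding \<open>r\<close>, every nonzero submodule
  contains the class of \<open>r\<close>; a non-torsion element \<open>v\<close> would then give \<open>r \<equiv> a v\<close> and also
  \<open>r \<equiv> b s a v\<close>, so that \<open>(1 - b s) a v \<equiv> 0\<close>.\<close>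

lemma torsion_submodule_avoiding:
  fixes N :: "('a::field poly ^ 'n) set"
  assumes N: "rowmod.subspace N" and r: "r \<notin> N"
  obtains N' where "rowmod.subspace N'" "N \<subseteq> N'" "r \<notin> N'" "\<And>v. \<exists>d. d \<noteq> 0 \<and> d *s v \<in> N'"
proof -
  define \<A> where "\<A> = {N'. rowmod.subspace N' \<and> N \<subseteq> N' \<and> r \<notin> N'}"
  have "\<exists>M\<in>\<A>. \<forall>X\<in>\<A>. M \<subseteq> X \<longrightarrow> X = M"
  proof (rule subset_Zorn_nonempty)
    show "\<A> \<noteq> {}"
      using N r by (auto simp: \<A>_def)
    fix \<C> assume \<C>: "\<C> \<noteq> {}" "subset.chain \<A> \<C>"
    have mem: "\<And>X. X \<in> \<C> \<Longrightarrow> rowmod.subspace X \<and> N \<subseteq> X \<and> r \<notin> X"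
      and lin: "\<And>X Y. X \<in> \<C> \<Longrightarrow> Y \<in> \<C> \<Longrightarrow> X \<subseteq> Y \<or> Y \<subseteq> X"
      using \<C>(2) unfolding subset.chain_def \<A>_def by auto
    have "rowmod.subspace (\<Union>\<C>)"
    proof (rule rowmod.subspaceI)
      show "0 \<in> \<Union>\<C>"
        using \<C>(1) mem rowmod.subspace_0 by blast
      show "x + y \<in> \<Union>\<C>" if "x \<in> \<Union>\<C>" "y \<in> \<Union>\<C>" for x y
      proof -
        from that obtain X Y where "X \<in> \<C>" "Y \<in> \<C>" "x \<in> X" "y \<in> Y" by blast
        moreover have "X \<subseteq> Y \<or> Y \<subseteq> X" using lin calculation by blast
        ultimately show ?thesis using mem rowmod.subspace_add by (metis UnionI subset_iff)
      qed
      show "c *s x \<in> \<Union>\<C>" if "x \<in> \<Union>\<C>" for c x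
        using that mem rowmod.subspace_scale by blast
    qed
    then show "\<Union>\<C> \<in> \<A>"
      using mem \<C>(1) unfolding \<A>_def by blast
  qed
  then obtain M where "M \<in> \<A>" and max_\<A>: "\<And>X. X \<in> \<A> \<Longrightarrow> M \<subseteq> X \<Longrightarrow> X = M"
    by auto
  then have M: "rowmod.subspace M" "N \<subseteq> M" "r \<notin> M"
    by (simp_all add: \<A>_def)
  have max: "X = M" if "rowmod.subspace X" "r \<notin> X" "M \<subseteq> X" for X
    using that M(2) by (intro max_\<A>) (auto simp: \<A>_def)
  have hit: "\<exists>c. r - c *s v \<in> M" if "v \<notin> M" for v
  proof (rule ccontr)
    assume no: "\<nexists>c. r - c *s v \<in> M"
    \<comment> \<open>\<open>X\<close> is the submodule generated by \<open>M\<close> and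
      \<open>v\<close>. If it avoided \<open>r\<close>, maximality would give \<open>X = M\<close>,
      although \<open>v\<close> is not in \<open>M\<close>.\<close>
    define X where "X = {x. \<exists>c. x - c *s v \<in> M}"
    have "rowmod.subspace X"
    proof (rule rowmod.subspaceI)
      show "0 \<in> X"
        unfolding X_def using rowmod.subspace_0[OF M(1)] by (auto intro!: exI[of _ 0])
      show "x + y \<in> X" if "x \<in> X" "y \<in> X" for x y
      proof -
        from that obtain c d where "x - c *s v \<in> M" "y - d *s v \<in> M" unfolding X_def by blast
        then have "(x - c *s v) + (y - d *s v) \<in> M" using M(1) rowmod.subspace_add by blast
        then have "x + y - (c + d) *s v \<in> M" by (simp add: algebra_simps)
        then show ?thesis unfolding X_def by blast
      qed
      show "c *s x \<in> X" if "x \<in> X" for c x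
      proof -
        from that obtain d where "x - d *s v \<in> M" unfolding X_def by blast
        then have "c *s (x - d *s v) \<in> M" using M(1) rowmod.subspace_scale by blast
        then have "c *s x - (c * d) *s v \<in> M" by (simp add: rowmod.scale_right_diff_distrib)
        then show ?thesis unfolding X_def by blast
      qed
    qed
    moreover have "r \<notin> X" using no by (simp add: X_def)
    moreover have "M \<subseteq> X" unfolding X_def by (auto intro!: exI[of _ 0])
    ultimately have "X = M" by (rule max)
    moreover have "v \<in> X"
      unfolding X_def using rowmod.subspace_0[OF M(1)] by (auto intro!: exI[of _ 1])
    ultimately show False using that by simp
  qed
  have "\<exists>d. d \<noteq> 0 \<and> d *s v \<in> M" for v
  proof (rule ccontr)
    assume free: "\<nexists>d. d \<noteq> 0 \<and> d *s v \<in> M"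
    have "1 *s v \<notin> M" using free one_neq_zero by blast
    then have "v \<notin> M" by simp
    then obtain a where a: "r - a *s v \<in> M" using hit by blast
    have "a \<noteq> 0" using a M(3) by auto
    \<comment> \<open>The indeterminate serves as a nonunit: \<open>s * b = 1\<close> fails at the
      point 0.\<close>
    define s :: "'a poly" where "s = monom 1 1"
    have "s * a \<noteq> 0" using \<open>a \<noteq> 0\<close> by (simp add: s_def)
    then have "(s * a) *s v \<notin> M" using free by blast
    then obtain b where b: "r - b *s ((s * a) *s v) \<in> M" using hit by blast
    have "(r - b *s ((s * a) *s v)) - (r - a *s v) \<in> M"
      using a b M(1) rowmod.subspace_diff by blast
    moreover have "(r - b *s ((s * a) *s v)) - (r - a *s v) = (a * (1 - s * b)) *s v"
      by (simp add: vec_eq_iff algebra_simps)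
    ultimately have "(a * (1 - s * b)) *s v \<in> M" by simp
    then have "a * (1 - s * b) = 0" using free by blast
    with \<open>a \<noteq> 0\<close> have "s * b = 1" by simp
    then have "poly (s * b) 0 = 1" by simp
    then show False by (simp add: s_def poly_monom)
  qed
  then show thesis by (rule that[OF M])
qed

text \<open>A nonsingular matrix with rows in \<open>N\<close> and determinant of minimal degree works: replacing its
  row \<open>i\<close> by the element of \<open>N\<close> left after division replaces the determinant by a remainder modulo it.\<close>

lemma torsion_submodule_eq_rowspace:
  fixes N :: "('a::field poly ^ 'n::finite) set"
  assumes N: "rowmod.subspace N" and tors: "\<And>v. \<exists>d. d \<noteq> 0 \<and> d *s v \<in> N"
  obtains P :: "'a poly ^ 'n ^ 'n" where "det P \<noteq> 0" "range (\<lambda>x. x v* P) = N"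
proof -
  define good where "good P \<longleftrightarrow> det P \<noteq> 0 \<and> (\<forall>i. P $ i \<in> N)" for P :: "'a poly ^ 'n ^ 'n"
  have "\<forall>i. \<exists>d. d \<noteq> 0 \<and> d *s axis i 1 \<in> N"
    using tors by blast
  from choice[OF this] obtain d where d: "\<And>i. d i \<noteq> 0 \<and> d i *s axis i 1 \<in> N"
    by blast
  \<comment> \<open>The diagonal matrix of torsion multipliers shows that good matrices exist, so
    one with determinant of least degree can be chosen.\<close>
  have "det (\<chi> i. d i *s axis i 1) = (\<Prod>i\<in>UNIV. d i)"
    by (subst det_diagonal) (auto simp: axis_def)
  then have "good (\<chi> i. d i *s axis i 1)"
    using d by (simp add: good_def)
  then obtain P where P: "good P" and least: "\<And>Q. good Q \<Longrightarrow> degree (det P) \<le> degree (det Q)"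
    using ex_has_least_nat[of good _ "\<lambda>P. degree (det P)"] by blast
  have det: "det P \<noteq> 0" and rows: "\<And>i. P $ i \<in> N"
    using P by (auto simp: good_def)
  have "r \<in> range (\<lambda>x. x v* P)" if "r \<in> N" for r
  proof (rule mem_rowspace_if_det_dvd[OF det])
    fix j
    \<comment> \<open>Division with remainder is done entrywise after multiplying by the adjugate;
      subtracting \<open>q v* P\<close> stays in \<open>N\<close> and leaves exactly the
      remainders.\<close>
    define q where "q = (\<chi> i. (r v* adjugate_mat P) $ i div det P)"
    define r' where "r' = r - q v* P"
    have "r' \<in> N"
      unfolding r'_def by (intro rowmod.subspace_diff N that vector_matrix_mult_in_subspace rows)
    have "r' v* adjugate_mat P = r v* adjugate_mat P - det P *s q"
      by (simp add: r'_def vector_matrix_mult_diff_distrib vector_matrix_mul_assoc matrix_mult_adjugate)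
    then have rem: "(r' v* adjugate_mat P) $ j = (r v* adjugate_mat P) $ j mod det P"
      by (simp add: q_def minus_mult_div_eq_mod)
    let ?Q = "\<chi> k. if k = j then r' else P $ k"
    have Q: "det ?Q = (r v* adjugate_mat P) $ j mod det P"
      using rem by (simp add: vector_matrix_mult_adjugate_nth)
    have "det ?Q = 0"
    proof (rule ccontr)
      assume nz: "det ?Q \<noteq> 0"
      moreover have "\<forall>i. ?Q $ i \<in> N"
        using \<open>r' \<in> N\<close> rows by simp
      ultimately have "degree (det P) \<le> degree (det ?Q)"
        unfolding good_def by (intro least) (simp add: good_def)
      moreover have "degree (det ?Q) < degree (det P)"
        using nz unfolding Q by (rule degree_mod_less'[OF det])
      ultimately show False by simp
    qed
    then show "det P dvd (r v* adjugate_mat P) $ j"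
      using Q by (simp add: mod_eq_0_iff_dvd)
  qed
  then have "range (\<lambda>x. x v* P) = N"
    using vector_matrix_mult_in_subspace[OF N rows] by blast
  with det show thesis by (rule that)
qed

subsection \<open>Scalar differential operators\<close>

definition smooth :: "(real \<Rightarrow> real) \<Rightarrow> bool" where
  "smooth v \<longleftrightarrow> (\<forall>k t. ((deriv ^^ k) v) differentiable (at t))"

definition pdop :: "real poly \<Rightarrow> (real \<Rightarrow> real) \<Rightarrow> real \<Rightarrow> real" where
  "pdop f v t = (\<Sum>k\<le>degree f. coeff f k * (deriv ^^ k) v t)"

lemma smooth_deriv_iter: "smooth v \<Longrightarrow> smooth ((deriv ^^ k) v)"
  by (simp add: smooth_def flip: funpow_add comp_apply[of "deriv ^^ _" "deriv ^^ _"])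

lemma smooth_deriv: "smooth v \<Longrightarrow> smooth (deriv v)"
  using smooth_deriv_iter[of v 1] by simp

lemma smooth_DERIV: "smooth v \<Longrightarrow> ((deriv ^^ k) v has_real_derivative (deriv ^^ Suc k) v t) (at t)"
  by (simp add: smooth_def DERIV_deriv_iff_real_differentiable)

text \<open>A chain of functions, each the derivative of the one before, must agree with the
  iterates of \<open>deriv\<close> by induction.\<close>

lemma smoothI:
  assumes "g 0 = v" and "\<And>k t. (g k has_real_derivative g (Suc k) t) (at t)"
  shows "smooth v" and "(deriv ^^ k) v = g k"
proof -
  have *: "(deriv ^^ k) v = g k" for k
    by (induction k) (auto simp: assms(1) intro!: DERIV_imp_deriv assms(2))
  then show "(deriv ^^ k) v = g k" .
  show "smooth v"
    unfolding smooth_def * using assms(2) real_differentiable_def by blast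
qed

text \<open>Linear combinations cover the operators \<open>pdop f\<close>, sums of two signals and,
  as the empty sum, the zero function.\<close>

lemma
  assumes "\<And>i. i \<in> I \<Longrightarrow> smooth (v i)"
  shows smooth_lincomb: "smooth (\<lambda>t. \<Sum>i\<in>I. c i * v i t)"
    and deriv_iter_lincomb:
      "(deriv ^^ k) (\<lambda>t. \<Sum>i\<in>I. c i * v i t) = (\<lambda>t. \<Sum>i\<in>I. c i * (deriv ^^ k) (v i) t)"
proof -
  note * = smoothI[where g = "\<lambda>k t. \<Sum>i\<in>I. c i * (deriv ^^ k) (v i) t" and v = "\<lambda>t. \<Sum>i\<in>I. c i * v i t"]
  have D: "((\<lambda>t. \<Sum>i\<in>I. c i * (deriv ^^ k) (v i) t) has_real_derivative
      (\<Sum>i\<in>I. c i * (deriv ^^ Suc k) (v i) t)) (at t)" for k t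
    by (intro DERIV_sum DERIV_cmult smooth_DERIV assms)
  show "smooth (\<lambda>t. \<Sum>i\<in>I. c i * v i t)"
    by (rule *(1)) (use D in auto)
  show "(deriv ^^ k) (\<lambda>t. \<Sum>i\<in>I. c i * v i t) = (\<lambda>t. \<Sum>i\<in>I. c i * (deriv ^^ k) (v i) t)"
    by (rule *(2)) (use D in auto)
qed

lemma pdop_eq_sum_le: "degree f \<le> n \<Longrightarrow> pdop f v t = (\<Sum>k\<le>n. coeff f k * (deriv ^^ k) v t)"
  unfolding pdop_def by (rule sum.mono_neutral_left) (auto simp: coeff_eq_0)

lemma pdop_0 [simp]: "pdop 0 v t = 0"
  by (simp add: pdop_def)

lemma pdop_add: "pdop (f + g) v t = pdop f v t + pdop g v t"
proof -
  let ?n = "max (degree f) (degree g)"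
  have "pdop (f + g) v t = (\<Sum>k\<le>?n. coeff (f + g) k * (deriv ^^ k) v t)"
    by (rule pdop_eq_sum_le) (rule degree_add_le_max)
  then show ?thesis
    by (simp add: pdop_eq_sum_le[of f ?n] pdop_eq_sum_le[of g ?n] sum.distrib algebra_simps)
qed

lemma pdop_sum: "pdop (\<Sum>i\<in>I. f i) v t = (\<Sum>i\<in>I. pdop (f i) v t)"
  by (induction I rule: infinite_finite_induct) (auto simp: pdop_add)

lemma pdop_smult: "pdop (smult c f) v t = c * pdop f v t"
  using pdop_eq_sum_le[OF degree_smult_le, of c f v t]
  by (simp add: pdop_def sum_distrib_left mult.assoc)

lemma pdop_pCons: "pdop (pCons a f) v t = a * v t + pdop f (deriv v) t"
proof -
  have "pdop (pCons a f) v t = (\<Sum>k\<le>Suc (degree f). coeff (pCons a f) k * (deriv ^^ k) v t)"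
    by (rule pdop_eq_sum_le) (rule degree_pCons_le)
  then show ?thesis
    by (simp only: sum.atMost_Suc_shift coeff_pCons_0 coeff_pCons_Suc funpow_Suc_right comp_apply
        funpow_0 pdop_def)
qed

lemma pdop_lincomb:
  assumes "\<And>i. i \<in> I \<Longrightarrow> smooth (v i)"
  shows "pdop f (\<lambda>t. \<Sum>i\<in>I. c i * v i t) t = (\<Sum>i\<in>I. c i * pdop f (v i) t)"
proof -
  have "pdop f (\<lambda>t. \<Sum>i\<in>I. c i * v i t) t
      = (\<Sum>k\<le>degree f. \<Sum>i\<in>I. coeff f k * (c i * (deriv ^^ k) (v i) t))"
    unfolding pdop_def by (subst deriv_iter_lincomb) (auto simp: assms sum_distrib_left)
  also have "\<dots> = (\<Sum>i\<in>I. \<Sum>k\<le>degree f. coeff f k * (c i * (deriv ^^ k) (v i) t))"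
    by (rule sum.swap)
  finally show ?thesis
    by (simp add: pdop_def sum_distrib_left mult.left_commute)
qed

lemma smooth_pdop: "smooth v \<Longrightarrow> smooth (pdop f v)"
  unfolding pdop_def[abs_def] by (rule smooth_lincomb) (rule smooth_deriv_iter)

lemma deriv_pdop:
  assumes "smooth v"
  shows "deriv (pdop f v) = pdop f (deriv v)"
  using deriv_iter_lincomb[where I = "{..degree f}" and v = "\<lambda>k. (deriv ^^ k) v" and c = "coeff f" and k = 1]
    smooth_deriv_iter[OF assms]
  by (simp add: pdop_def[abs_def] funpow_swap1)

text \<open>Peeling one factor of the indeterminate off \<open>f\<close> moves a derivative onto
  \<open>v\<close>, and \<open>pdop g\<close> commutes with \<open>deriv\<close>.\<close>

lemma pdop_mult: "smooth v \<Longrightarrow> pdop (f * g) v t = pdop f (pdop g v) t"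
proof (induction f arbitrary: v)
  case 0
  then show ?case by simp
next
  case (pCons a f)
  have "pdop (f * g) (deriv v) t = pdop f (deriv (pdop g v)) t"
    by (simp add: pCons smooth_deriv deriv_pdop)
  then show ?case
    by (simp add: pdop_add pdop_smult pdop_pCons)
qed

lemma smooth_zero: "smooth (\<lambda>_. 0)" and pdop_zero: "pdop f (\<lambda>_. 0) t = 0"
  using smooth_lincomb[of "{}"] pdop_lincomb[of "{}" "\<lambda>_. undefined" f "\<lambda>_. 0"] by simp_all

section \<open>Power series solutions of scalar equations\<close>

text \<open>The geometric bound lets an exponential series dominate, so the series converges
  everywhere; termwise differentiation of an exponential generating function shifts its
  coefficients.\<close>

lemma smooth_egf:
  fixes a :: "nat \<Rightarrow> real"
  assumes "\<And>k. \<bar>a k\<bar> \<le> C ^ k"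
  defines "v \<equiv> \<lambda>t. \<Sum>n. (a n / fact n) * t ^ n"
  shows "smooth v" and "(deriv ^^ k) v = (\<lambda>t. \<Sum>n. (a (n + k) / fact n) * t ^ n)"
    and "summable (\<lambda>n. (a (n + k) / fact n) * t ^ n)"
proof -
  have summ: "summable (\<lambda>n. (a (n + k) / fact n) * t ^ n)" for k t
  proof (rule summable_comparison_test)
    show "\<exists>N. \<forall>n\<ge>N. norm ((a (n + k) / fact n) * t ^ n) \<le> C ^ k * ((C * \<bar>t\<bar>) ^ n /\<^sub>R fact n)"
    proof (intro exI allI impI)
      fix n
      have "norm ((a (n + k) / fact n) * t ^ n) = \<bar>a (n + k)\<bar> * (\<bar>t\<bar> ^ n / fact n)"
        by (simp add: abs_mult power_abs)
      also have "\<dots> \<le> C ^ (n + k) * (\<bar>t\<bar> ^ n / fact n)"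
        by (intro mult_right_mono assms(1)) auto
      finally show "norm ((a (n + k) / fact n) * t ^ n) \<le> C ^ k * ((C * \<bar>t\<bar>) ^ n /\<^sub>R fact n)"
        by (simp add: power_add power_mult_distrib field_simps)
    qed
    show "summable (\<lambda>n. C ^ k * ((C * \<bar>t\<bar>) ^ n /\<^sub>R fact n))"
      by (intro summable_mult summable_exp_generic)
  qed
  then show "summable (\<lambda>n. (a (n + k) / fact n) * t ^ n)" .
  define g where "g k t = (\<Sum>n. (a (n + k) / fact n) * t ^ n)" for k t
  have D: "(g k has_real_derivative g (Suc k) t) (at t)" for k t
  proof -
    have "diffs (\<lambda>n. a (n + k) / fact n) = (\<lambda>n. a (n + Suc k) / fact n)"
      by (auto simp: diffs_def fact_Suc)
    then show ?thesis
      using termdiffs_strong_converges_everywhere[OF summ, of k t]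
      unfolding g_def[abs_def] by simp
  qed
  have g0: "g 0 = v" by (auto simp: g_def v_def)
  show "smooth v" using smoothI(1)[of g, OF g0 D] .
  show "(deriv ^^ k) v = (\<lambda>t. \<Sum>n. (a (n + k) / fact n) * t ^ n)"
    using smoothI(2)[of g, OF g0 D] by (auto simp: g_def)
qed

text \<open>Passing from the remainder of \<open>s^k\<close> to that of \<open>s^(k+1)\<close> means
  multiplying by \<open>s\<close> and subtracting one multiple of \<open>\<delta>\<close>, which
  enlarges the coefficients by a factor of at most \<open>C\<close>.\<close>

lemma coeff_monom_mod_bound:
  fixes \<delta> :: "real poly"
  assumes "degree \<delta> > 0"
  shows "\<exists>C. \<forall>k j. \<bar>coeff (monom 1 k mod \<delta>) j\<bar> \<le> C ^ k"
proof -
  define n where "n = degree \<delta>"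
  define L where "L = lead_coeff \<delta>"
  define C where "C = 1 + (\<Sum>i\<le>n. \<bar>coeff \<delta> i / L\<bar>)"
  have "\<delta> \<noteq> 0" using assms by auto
  then have L: "L \<noteq> 0" by (simp add: L_def)
  have C: "C \<ge> 1" by (auto simp: C_def intro: sum_nonneg)
  have coeff_C: "\<bar>coeff \<delta> i / L\<bar> \<le> C - 1" for i
  proof (cases "i \<le> n")
    case True
    then show ?thesis
      unfolding C_def using member_le_sum[of i "{..n}" "\<lambda>i. \<bar>coeff \<delta> i / L\<bar>"] by simp
  next
    case False
    then show ?thesis using C by (simp add: n_def coeff_eq_0)
  qed
  have "\<bar>coeff (monom 1 k mod \<delta>) j\<bar> \<le> C ^ k" for k j
  proof (induction k arbitrary: j)
    case 0
    have "monom 1 0 mod \<delta> = (1 :: real poly)"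
      using assms by (simp add: mod_poly_less monom_0 one_pCons)
    then show ?case by (simp add: coeff_1)
  next
    case (Suc k)
    define p where "p = monom 1 k mod \<delta>"
    define c where "c = coeff p (n - 1)"
    \<comment> \<open>The subtracted multiple cancels the coefficient at degree \<open>n\<close>, so
      \<open>q\<close> is already reduced modulo \<open>\<delta>\<close>.\<close>
    define q where "q = pCons 0 p - smult (c / L) \<delta>"
    have dp: "degree p < n"
      using degree_mod_less[OF \<open>\<delta> \<noteq> 0\<close>, of "monom 1 k"] assms by (auto simp: p_def n_def)
    have "degree q < n"
    proof -
      have "coeff q i = 0" if "i \<ge> n" for i
      proof (cases "i = n")
        case True
        then show ?thesis
          using L assms unfolding L_def n_def[symmetric] by (cases n) (simp_all add: q_def c_def n_def[symmetric] L_def)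
      next
        case False
        then show ?thesis
          using that dp by (cases i) (auto simp: q_def n_def coeff_eq_0)
      qed
      then have "degree q \<le> n - 1"
        by (intro degree_le) auto
      then show ?thesis using assms by (simp add: n_def)
    qed
    have "monom 1 (Suc k) mod \<delta> = ([:0, 1:] * monom 1 k) mod \<delta>"
      by (simp add: monom_Suc)
    also have "\<dots> = ([:0, 1:] * p) mod \<delta>"
      unfolding p_def by (rule mod_mult_right_eq[symmetric])
    also have "\<dots> = (q + smult (c / L) \<delta>) mod \<delta>"
      by (simp add: q_def)
    also have "\<dots> = q"
      using \<open>degree q < n\<close> by (simp add: poly_mod_add_left mod_smult_left mod_poly_less n_def)
    finally have eq: "coeff (monom 1 (Suc k) mod \<delta>) j = coeff q j" by simp
    have "\<bar>coeff (pCons 0 p) j\<bar> \<le> C ^ k"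
      using Suc.IH C by (cases j) (auto simp: p_def)
    moreover have "\<bar>c / L * coeff \<delta> j\<bar> \<le> C ^ k * (C - 1)"
    proof -
      have "\<bar>c\<bar> \<le> C ^ k" using Suc.IH by (simp add: c_def p_def)
      then have "\<bar>c\<bar> * \<bar>coeff \<delta> j / L\<bar> \<le> C ^ k * (C - 1)"
        using coeff_C C by (intro mult_mono) auto
      then show ?thesis by (simp add: abs_mult)
    qed
    moreover have "\<bar>coeff q j\<bar> \<le> \<bar>coeff (pCons 0 p) j\<bar> + \<bar>c / L * coeff \<delta> j\<bar>"
      unfolding q_def by (simp only: coeff_diff coeff_smult abs_triangle_ineq4)
    ultimately have "\<bar>coeff q j\<bar> \<le> C ^ k + C ^ k * (C - 1)"
      by linarith
    then show ?case
      unfolding eq by (simp add: algebra_simps)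
  qed
  then show ?thesis by blast
qed

text \<open>The function with derivatives \<open>\<phi> (s\<^sup>k mod \<delta>)\<close> at 0 is annihilated by \<open>\<delta>\<close>, for every
  linear functional \<open>\<phi>\<close> on remainders; take for \<open>\<phi>\<close> the coefficient at the degree of \<open>c mod \<delta>\<close>.\<close>

lemma dvd_if_kernel_subset:
  fixes \<delta> c :: "real poly"
  assumes "\<delta> \<noteq> 0"
    and ker: "\<And>v. smooth v \<Longrightarrow> (\<And>t. pdop \<delta> v t = 0) \<Longrightarrow> pdop c v 0 = 0"
  shows "\<delta> dvd c"
proof (rule ccontr)
  assume ndvd: "\<not> \<delta> dvd c"
  then have "degree \<delta> > 0"
    using assms(1) is_unit_iff_degree unit_imp_dvd by blast
  define m where "m = degree (c mod \<delta>)"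
  define a where "a k = coeff (monom 1 k mod \<delta>) m" for k
  define v where "v t = (\<Sum>n. (a n / fact n) * t ^ n)" for t
  obtain C where C: "\<And>k. \<bar>a k\<bar> \<le> C ^ k"
    using coeff_monom_mod_bound[OF \<open>degree \<delta> > 0\<close>] by (auto simp: a_def)
  note egf = smooth_egf[OF C, folded v_def[abs_def]]
  \<comment> \<open>This is linearity of the functional. For \<open>f = \<delta>\<close> the right
    side is 0; for \<open>f = c\<close> and \<open>n = 0\<close> it is the leading coefficient of
    \<open>c mod \<delta>\<close>.\<close>
  have annihilated: "(\<Sum>k\<le>degree f. coeff f k * a (n + k)) = coeff ((monom 1 n * f) mod \<delta>) m" for f n
  proof -
    have "monom 1 n * f = (\<Sum>k\<le>degree f. smult (coeff f k) (monom 1 (n + k)))"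
      by (subst (1) poly_as_sum_of_monoms[symmetric]) (simp add: sum_distrib_left mult_monom smult_monom)
    moreover have "(\<Sum>k\<in>A. g k) mod \<delta> = (\<Sum>k\<in>A. g k mod \<delta>)" for g and A :: "nat set"
      by (induction A rule: infinite_finite_induct) (auto simp: poly_mod_add_left)
    ultimately show ?thesis
      by (simp add: mod_smult_left coeff_sum a_def)
  qed
  have "pdop \<delta> v t = 0" for t
  proof -
    have "pdop \<delta> v t = (\<Sum>n. (\<Sum>k\<le>degree \<delta>. coeff \<delta> k * ((a (n + k) / fact n) * t ^ n)))"
      unfolding pdop_def egf(2) by (simp only: suminf_sum egf(3) suminf_mult summable_mult)
    also have "\<dots> = (\<Sum>n. (\<Sum>k\<le>degree \<delta>. coeff \<delta> k * a (n + k)) * (t ^ n / fact n))"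
      by (simp add: sum_distrib_right sum_divide_distrib mult.assoc)
    also have "\<dots> = 0"
      by (simp add: annihilated)
    finally show ?thesis .
  qed
  then have "pdop c v 0 = 0"
    using ker egf(1) by blast
  moreover have "(deriv ^^ k) v 0 = a k" for k
    unfolding egf(2) by (subst powser_zero) simp
  ultimately have "coeff (c mod \<delta>) m = 0"
    using annihilated[of c 0] by (simp add: pdop_def flip: one_pCons monom_0)
  then show False
    using ndvd by (simp add: m_def mod_eq_0_iff_dvd)
qed

subsection \<open>Behaviours and contracts\<close>

lemma smooth_sig_iff: "smooth_sig w \<longleftrightarrow> (\<forall>i. smooth (\<lambda>s. w s $ i))"
  by (simp add: smooth_sig_def smooth_def)

lemma pdiff_eq_pdop: "pdiff r w t = (\<Sum>i\<in>UNIV. pdop (r $ i) (\<lambda>s. w s $ i) t)"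
  by (simp add: pdiff_def pdop_def)

lemma smooth_sig_zero: "smooth_sig (\<lambda>_. 0)"
  by (simp add: smooth_sig_iff smooth_zero)

lemma pdiff_zero_left [simp]: "pdiff 0 w t = 0"
  by (simp add: pdiff_eq_pdop)

lemma pdiff_zero_right: "pdiff r (\<lambda>_. 0) t = 0"
  by (simp add: pdiff_eq_pdop pdop_zero)

lemma
  assumes "smooth_sig v" "smooth_sig w"
  shows smooth_sig_add: "smooth_sig (\<lambda>t. v t + w t)"
    and pdiff_add_right: "pdiff r (\<lambda>t. v t + w t) t = pdiff r v t + pdiff r w t"
proof -
  \<comment> \<open>A sum of two signals is treated as a sum over \<open>bool\<close> with unit
    coefficients.\<close>
  have sm: "smooth (\<lambda>s. (if b then v s else w s) $ i)" for b i
    using assms by (cases b) (auto simp: smooth_sig_iff)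
  note l = smooth_lincomb[of UNIV "\<lambda>b s. (if b then v s else w s) $ _" "\<lambda>_. 1", OF sm]
    pdop_lincomb[of UNIV "\<lambda>b s. (if b then v s else w s) $ _" _ "\<lambda>_. 1", OF sm]
  show "smooth_sig (\<lambda>t. v t + w t)"
    using l(1) by (simp add: smooth_sig_iff UNIV_bool add.commute)
  show "pdiff r (\<lambda>t. v t + w t) t = pdiff r v t + pdiff r w t"
    using l(2) by (simp add: pdiff_eq_pdop UNIV_bool add.commute sum.distrib)
qed

text \<open>Composition of operators matches multiplication of matrices; hence every equation in the
  row module follows from the rows.\<close>

lemma pdiff_vector_matrix_mult:
  assumes "smooth_sig w"
  shows "pdiff (x v* P) w t = (\<Sum>j\<in>UNIV. pdop (x $ j) (pdiff (P $ j) w) t)"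
proof -
  have sm: "smooth (\<lambda>s. w s $ i)" for i
    using assms by (simp add: smooth_sig_iff)
  have "pdiff (x v* P) w t
      = (\<Sum>i\<in>UNIV. \<Sum>j\<in>UNIV. pdop (x $ j) (pdop (P $ j $ i) (\<lambda>s. w s $ i)) t)"
    by (simp add: pdiff_eq_pdop vector_matrix_mult_def pdop_sum pdop_mult sm)
  also have "\<dots> = (\<Sum>j\<in>UNIV. \<Sum>i\<in>UNIV. pdop (x $ j) (pdop (P $ j $ i) (\<lambda>s. w s $ i)) t)"
    by (rule sum.swap)
  also have "\<dots> = (\<Sum>j\<in>UNIV. pdop (x $ j) (pdiff (P $ j) w) t)"
    using pdop_lincomb[of UNIV "\<lambda>i. pdop (P $ _ $ i) (\<lambda>s. w s $ i)" _ "\<lambda>_. 1" t]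
    by (simp add: pdiff_eq_pdop[abs_def] smooth_pdop sm)
  finally show ?thesis .
qed

lemma pdiff_eq_0_if_in_rowspace:
  assumes "w \<in> ker_mat P" "r \<in> range (\<lambda>x. x v* P)"
  shows "pdiff r w t = 0"
proof -
  have "pdiff (P $ j) w = (\<lambda>_. 0)" for j
    using assms(1) by (auto simp: ker_mat_def)
  then show ?thesis
    using assms by (auto simp: ker_mat_def pdiff_vector_matrix_mult pdop_zero)
qed

text \<open>If \<open>det P\<close> annihilates the scalar function \<open>v\<close>, then each column of the adjugate applied to
  \<open>v\<close> lies in the kernel of \<open>P\<close>; so \<open>det P\<close> divides every entry of \<open>r adj P\<close>.\<close>

lemma in_rowspace_if_kernel_subset:
  fixes P :: "real poly ^ 'n::finite ^ 'n"
  assumes det: "det P \<noteq> 0" and ker: "\<And>w t. w \<in> ker_mat P \<Longrightarrow> pdiff r w t = 0"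
  shows "r \<in> range (\<lambda>x. x v* P)"
proof (rule mem_rowspace_if_det_dvd[OF det], rule dvd_if_kernel_subset[OF det])
  fix j v assume v: "smooth v" "\<And>t. pdop (det P) v t = 0"
  define w where "w t = (\<chi> i. pdop (adjugate_mat P $ i $ j) v t)" for t
  have w: "smooth_sig w"
    by (simp add: w_def smooth_sig_iff smooth_pdop v(1))
  have pdiff_w: "pdiff x w t = pdop ((x v* adjugate_mat P) $ j) v t" for x t
    by (simp add: w_def pdiff_eq_pdop vector_matrix_mult_def pdop_sum pdop_mult v(1))
  have "pdiff (P $ i) w t = 0" for i t
    by (simp add: pdiff_w row_mult_adjugate axis_def v(2))
  then have "w \<in> ker_mat P"
    using w by (simp add: ker_mat_def)
  then show "pdop ((r v* adjugate_mat P) $ j) v 0 = 0"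
    using ker pdiff_w by metis
qed

lemma ker_mat_subset_if_nonsingular:
  fixes G :: "real poly ^ 'p::finite ^ 'g::finite" and H :: "real poly ^ 'p ^ 'h::finite"
  assumes "\<And>P :: real poly ^ 'p ^ 'p. det P \<noteq> 0 \<Longrightarrow> ker_mat P \<subseteq> ker_mat G \<Longrightarrow> ker_mat P \<subseteq> ker_mat H"
  shows "ker_mat G \<subseteq> ker_mat H"
proof -
  have "H $ k \<in> range (\<lambda>x. x v* G)" for k
  proof (rule ccontr)
    assume "H $ k \<notin> range (\<lambda>x. x v* G)"
    then obtain N where N: "rowmod.subspace N" "range (\<lambda>x. x v* G) \<subseteq> N" "H $ k \<notin> N"
        "\<And>v. \<exists>d. d \<noteq> 0 \<and> d *s v \<in> N"
      using torsion_submodule_avoiding[OF subspace_rowspace] by metis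
    obtain P :: "real poly ^ 'p ^ 'p" where P: "det P \<noteq> 0" "range (\<lambda>x. x v* P) = N"
      using torsion_submodule_eq_rowspace[OF N(1,4)] by blast
    have "ker_mat P \<subseteq> ker_mat G"
    proof
      fix w assume w: "w \<in> ker_mat P"
      have "G $ i \<in> range (\<lambda>x. x v* P)" for i
        using row_in_rowspace[of G i] N(2) P(2) by blast
      then have "pdiff (G $ i) w t = 0" for i t
        by (rule pdiff_eq_0_if_in_rowspace[OF w])
      then show "w \<in> ker_mat G"
        using w by (simp add: ker_mat_def)
    qed
    then have "ker_mat P \<subseteq> ker_mat H"
      using assms P(1) by blast
    then have "H $ k \<in> range (\<lambda>x. x v* P)"
      by (intro in_rowspace_if_kernel_subset P(1)) (auto simp: ker_mat_def)
    with P(2) N(3) show False by simp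
  qed
  then show ?thesis
    using pdiff_eq_0_if_in_rowspace by (fastforce simp: ker_mat_def)
qed

section \<open>Environments, implementations and refinement\<close>

lemma zero_in_ker_list: "(\<lambda>_. 0) \<in> ker_list E"
  by (simp add: ker_list_def smooth_sig_zero pdiff_zero_right)

text \<open>Listing the rows of \<open>A\<close> gives the largest environment compatible with the
  assumptions \<open>A\<close>.\<close>

lemma ex_ker_list_eq_ker_mat:
  fixes A :: "real poly ^ 'm::finite ^ 'r::finite"
  obtains E where "ker_list E = ker_mat A"
proof -
  obtain E where "set E = range (($) A)"
    using finite_list[of "range (($) A)"] by auto
  then show thesis
    by (intro that[of E]) (auto simp: ker_list_def ker_mat_def)
qed

lemma ker_mat_meet_mat: "ker_mat (meet_mat G1 G2) = ker_mat G1 \<inter> ker_mat G2"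
  by (auto simp: ker_mat_def meet_mat_def split_sum_all)

text \<open>Latent signals of two summands add up to a latent signal of the sum. This makes the join
  a least upper bound.\<close>

lemma join_beh_subset_latent_beh:
  assumes "ker_mat A1 \<subseteq> latent_beh R M" "ker_mat A2 \<subseteq> latent_beh R M"
  shows "join_beh A1 A2 \<subseteq> latent_beh R M"
proof
  fix u assume "u \<in> join_beh A1 A2"
  then obtain v1 v2 where u: "\<And>t. v1 t + v2 t = u t" and "v1 \<in> ker_mat A1" "v2 \<in> ker_mat A2"
    by (auto simp: join_beh_def)
  with assms have "v1 \<in> latent_beh R M" "v2 \<in> latent_beh R M" by auto
  then obtain l1 l2 where v: "smooth_sig v1" "smooth_sig v2" and l: "smooth_sig l1" "smooth_sig l2"
    and eq: "\<And>j t. pdiff (R $ j) v1 t = pdiff (M $ j) l1 t" "\<And>j t. pdiff (R $ j) v2 t = pdiff (M $ j) l2 t"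
    by (auto simp: latent_beh_def)
  have u: "u = (\<lambda>t. v1 t + v2 t)" by (simp add: u)
  show "u \<in> latent_beh R M"
    unfolding latent_beh_def u
    using v l eq by (auto simp: smooth_sig_add pdiff_add_right intro!: exI[of _ "\<lambda>t. l1 t + l2 t"])
qed

lemma implements_mono:
  assumes "implements P Q (A, B)" "A' \<subseteq> A" "B \<subseteq> B'"
  shows "implements P Q (A', B')"
  using assms by (fastforce simp: implements_def compatible_def)

lemma refines_if_subset: "A' \<subseteq> A \<Longrightarrow> B \<subseteq> B' \<Longrightarrow> refines (A, B) (A', B')"
  using implements_mono by (fastforce simp: refines_def compatible_def)

text \<open>The zero transfer matrix is proper, and the zero input lies in every environment, so the
  outputs always form \<open>ker_mat P\<close>. Without a compatible environment the output
  condition is vacuous, hence the existential premise.\<close>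

lemma implements_zero_input_iff:
  "implements P 0 (A, B) \<longleftrightarrow> det P \<noteq> 0 \<and> ((\<exists>E. ker_list E \<subseteq> A) \<longrightarrow> ker_mat P \<subseteq> B)"
proof -
  have "out_beh E P 0 = ker_mat P" for E
    using zero_in_ker_list[of E] smooth_sig_zero
    by (auto simp: out_beh_def sys_beh_def ker_mat_def ker_list_def)
  then show ?thesis
    by (auto simp: implements_def io_form_def compatible_def)
qed

text \<open>The set \<open>B\<close> is arbitrary so that both joins and latent-variable assumptions
  fit. For the forward direction, \<open>ker_mat A\<close> itself serves as environment and the
  systems with zero input matrix test the guarantees.\<close>

lemma refines_ker_mat_iff:
  fixes G :: "real poly ^ 'p::finite ^ 'g::finite" and A :: "real poly ^ 'm::finite ^ 'a::finite"
    and H :: "real poly ^ 'p ^ 'h::finite"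
  shows "refines (B, ker_mat G) (ker_mat A, ker_mat H) \<longleftrightarrow> ker_mat A \<subseteq> B \<and> ker_mat G \<subseteq> ker_mat H"
proof
  assume ref: "refines (B, ker_mat G) (ker_mat A, ker_mat H)"
  obtain E where E: "ker_list E = ker_mat A"
    by (rule ex_ker_list_eq_ker_mat)
  with ref have "ker_mat A \<subseteq> B"
    by (force simp: refines_def compatible_def)
  moreover have "ker_mat G \<subseteq> ker_mat H"
  proof (rule ker_mat_subset_if_nonsingular)
    fix P :: "real poly ^ 'p ^ 'p"
    assume "det P \<noteq> 0" "ker_mat P \<subseteq> ker_mat G"
    then have "implements P 0 (B, ker_mat G)"
      by (simp add: implements_zero_input_iff)
    then have "implements P 0 (ker_mat A, ker_mat H)"
      using ref by (simp add: refines_def)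
    then show "ker_mat P \<subseteq> ker_mat H"
      using E by (auto simp: implements_zero_input_iff)
  qed
  ultimately show "ker_mat A \<subseteq> B \<and> ker_mat G \<subseteq> ker_mat H" ..
qed (simp add: refines_if_subset)

lemma zero_in_ker_mat: "(\<lambda>_. 0) \<in> ker_mat A"
  by (simp add: ker_mat_def smooth_sig_zero pdiff_zero_right)

lemma ker_mat_subset_join_beh:
  shows "ker_mat A1 \<subseteq> join_beh A1 A2" and "ker_mat A2 \<subseteq> join_beh A1 A2"
proof -
  have I: "w \<in> join_beh A1 A2" if "v1 \<in> ker_mat A1" "v2 \<in> ker_mat A2" "\<And>t. v1 t + v2 t = w t" for w v1 v2
  proof -
    have "smooth_sig v1" "smooth_sig v2"
      using that by (auto simp: ker_mat_def)
    then show ?thesis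
      using that unfolding join_beh_def by blast
  qed
  show "ker_mat A1 \<subseteq> join_beh A1 A2"
    using I[OF _ zero_in_ker_mat] by auto
  show "ker_mat A2 \<subseteq> join_beh A1 A2"
    using I[OF zero_in_ker_mat] by auto
qed

theorem theorem5:
  fixes A1 :: "real poly ^ 'm::finite ^ 'a1::finite"
    and A2 :: "real poly ^ 'm ^ 'a2::finite"
    and G1 :: "real poly ^ 'p::finite ^ 'g1::finite"
    and G2 :: "real poly ^ 'p ^ 'g2::finite"
  defines "C1 \<equiv> (ker_mat A1, ker_mat G1)"
    and "C2 \<equiv> (ker_mat A2, ker_mat G2)"
    and "Cconj \<equiv> (join_beh A1 A2, ker_mat (meet_mat G1 G2))"
  shows "refines Cconj C1 \<and> refines Cconj C2 \<and>
    (\<forall>(R :: real poly ^ 'm ^ 'r::finite) (M :: real poly ^ 'l::finite ^ 'r) (G :: real poly ^ 'p ^ 'g::finite).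
        refines (latent_beh R M, ker_mat G) C1 \<and> refines (latent_beh R M, ker_mat G) C2 \<longrightarrow>
        refines (latent_beh R M, ker_mat G) Cconj)"
  \<comment> \<open>Refinements of \<open>C1\<close> and \<open>C2\<close> become inclusions of
    behaviours; the refinement of \<open>Cconj\<close> then needs only that the join is least and
    that the meet has the intersection as its kernel.\<close>
  unfolding C1_def C2_def Cconj_def refines_ker_mat_iff ker_mat_meet_mat
  by (intro conjI allI impI refines_if_subset join_beh_subset_latent_beh ker_mat_subset_join_beh) auto

end
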